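(* Let $n$ be a positive integer and $\alpha>0$. For each integer $\ell$ with $0\le\ell\le\lfloor n/2\rfloor$ let $Q_n^{(\ell)}$ be the generator of the symmetric exclusion process with respect to $(K_n,\alpha,\ell)$, where $K_n$ is the complete graph on $n$ vertices, and let $\{\psi_i^{(n,\ell)}\}_{i=1}^{\binom n\ell}$ be an orthonormal basis of eigenvectors of $-Q_n^{(\ell)}$ with corresponding eigenvalues $\{\lambda_i^{(n,\ell)}\}_i$, ordered so that $$0=\lambda_1^{(n,\ell)}<\lambda_2^{(n,\ell)}\le\lambda_3^{(n,\ell)}\le\cdots\le\lambda^{(n,\ell)}_{\binom n\ell}.$$ Then for each $\ell\in\{1,2,\dots,\lfloor n/2\rfloor\}$: (a) for each $j=1,\dots,\ell$, the eigenvalue $\alpha j(n-j+1)$ of $-Q_n^{(\ell)}$ has multiplicity $\binom nj-\binom n{j-1}$; (b) an orthogonal basis of eigenvectors of $-Q_n^{(\ell-1)}$ is given by $\{(\psi_i^{(n,\ell)})_+\}_{i\in\{1,2,\dots,\binom n{\ell-1}\}}$; (c) for $i\in\{1,2,\dots,\binom n{\ell-1}\}$, we can pick (i.e. the orthonormal eigenbasis of $-Q_n^{(\ell)}$ can be chosen so that) $\psi_i^{(n,\ell)}=C_i\,(\psi_i^{(n,\ell-1)})_-$ for some normalizing constants $C_i>0$ that depend on $i,n,\ell$ and $\alpha$; (d) for any integer $m$ with $0\le m<\ell$, we can pick the eigenvectors $\psi_i^{(n,\ell)}$ of $-Q_n^{(\ell)}$ with eigenvalue less than or equal to $\alpha m(n-m+1)$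 in such a way that any such eigenvector can be written as $$\psi_i^{(n,\ell)}(x)=C_i'\sum_{y\le x\colon\|y\|=m}\psi_i^{(n,m)}(y),\qquad x\in\tbinom{V(K_n)}{\ell},$$ for normalizing constants $C_i'>0$ that depend on $i,n,\ell,\alpha$ and $m$; moreover, $\lambda_i^{(n,\ell)}=\lambda_i^{(n,m)}$ for all such $i$.
   Context: For a finite graph $G$ with vertex set $V(G)$, $\binom{V(G)}{\ell}$ denotes the set of configurations $x\in\{0,1\}^{V(G)}$ with exactly $\ell$ ones (black marbles). For $e\in E(G)$, $x_e$ is the configuration obtained from $x$ by interchanging the values at the endpoints of $e$. The symmetric exclusion process with respect to $(G,\alpha,\ell)$ is the continuous-time Markov chain on $\binom{V(G)}{\ell}$ with generator $Q^{(\ell)}f(x)=\alpha\sum_{e\in E(G)}(f(x_e)-f(x))$, started from the uniform distribution on $\binom{V(G)}{\ell}$. Orthogonality and orthonormality of functions $f,g\colon\binom{V(G)}{\ell}\to\mathbb R$ are with respect to $\langle f,g\rangle=\binom{|V(G)|}{\ell}^{-1}\sum_{x\in\binom{V(G)}{\ell}}f(x)g(x)$. For $x\in\{0,1\}^{V(G)}$ and $v\in V(G)$, $x_v$ denotes the configuration which differs from $x$ exactly at $v$; $\|x\|=\sum_v x(v)$; and $y\le x$ means $y(v)\le x(v)$ for all $v\in V(G)$. For $\psi\colon\binom{V(G)}{\ell}\to\mathbb R$ define $$\psi_+(x)=\sum_{v\colon x(v)=0}\psi(x_v),\quad x\in\tbinom{V(G)}{\ell-1},\qquad \psi_-(x)=\sum_{v\colon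 x(v)=1}\psi(x_v),\quad x\in\tbinom{V(G)}{\ell+1}.$$ *)

theory Defs
  imports "HOL-Analysis.Analysis"
begin

text \<open>
  The vertex set of a graph is a finite type \<open>'v\<close>; a simple graph on it is given by its edge set,
  a set of two-element sets. Configurations in $\{0,1\}^V$ are predicates on vertices, with
  \<^const>\<open>True\<close> for a black marble, so that \<open>y \<le> x\<close> is the pointwise order.
\<close>

type_synonym 'v config = "'v \<Rightarrow> bool"

definition complete_edges :: "'v::finite set set" where
  "complete_edges = {e. card e = 2}"

definition ones :: "'v::finite config \<Rightarrow> nat" where
  "ones x = (\<Sum>v\<in>UNIV. of_bool (x v))"

definition level :: "nat \<Rightarrow> 'v::finite config set" where
  "level l = {x. ones x = l}"

text \<open>For \<open>e = {u, v}\<close> and \<open>w \<in> e\<close>, the endpoint of \<open>e\<close> other than \<open>w\<close> is \<open>the_elem (e - {w})\<close>.\<close>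

definition swap_edge :: "'v set \<Rightarrow> 'v config \<Rightarrow> 'v config" where
  "swap_edge e x = (\<lambda>w. if w \<in> e then x (the_elem (e - {w})) else x w)"

definition flip_at :: "'v \<Rightarrow> 'v config \<Rightarrow> 'v config" where
  "flip_at v x = x(v := \<not> x v)"

text \<open>
  Real functions on the configurations with \<open>l\<close> ones are the vectors indexed by all
  configurations that vanish outside \<^term>\<open>level l\<close>.
\<close>

definition level_fun :: "nat \<Rightarrow> (real ^ ('v::finite config)) set" where
  "level_fun l = {f. \<forall>x. x \<notin> level l \<longrightarrow> f $ x = 0}"

definition level_inner :: "nat \<Rightarrow> real ^ ('v::finite config) \<Rightarrow> real ^ ('v config) \<Rightarrow> real" where
  "level_inner l f g = inverse (real (CARD('v) choose l)) * (\<Sum>x\<in>level l. f $ x * g $ x)"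

definition sep_generator ::
  "'v::finite set set \<Rightarrow> real \<Rightarrow> nat \<Rightarrow> real ^ ('v config) \<Rightarrow> real ^ ('v config)" where
  "sep_generator E \<alpha> l f =
     (\<chi> x. if x \<in> level l then \<alpha> * (\<Sum>e\<in>E. f $ swap_edge e x - f $ x) else 0)"

text \<open>The eigenvalues and eigenvectors below are those of the negated generator.\<close>

definition sep_eigenspace ::
  "'v::finite set set \<Rightarrow> real \<Rightarrow> nat \<Rightarrow> real \<Rightarrow> (real ^ ('v config)) set" where
  "sep_eigenspace E \<alpha> l \<mu> = {f \<in> level_fun l. - sep_generator E \<alpha> l f = \<mu> *\<^sub>R f}"

definition sep_eigenvector ::
  "'v::finite set set \<Rightarrow> real \<Rightarrow> nat \<Rightarrow> real \<Rightarrow> real ^ ('v config) \<Rightarrow> bool" where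
  "sep_eigenvector E \<alpha> l \<mu> f \<longleftrightarrow> f \<in> sep_eigenspace E \<alpha> l \<mu> \<and> f \<noteq> 0"

definition sep_multiplicity :: "'v::finite set set \<Rightarrow> real \<Rightarrow> nat \<Rightarrow> real \<Rightarrow> nat" where
  "sep_multiplicity E \<alpha> l \<mu> = dim (sep_eigenspace E \<alpha> l \<mu>)"

definition family_basis :: "nat set \<Rightarrow> (nat \<Rightarrow> 'b::real_vector) \<Rightarrow> 'b set \<Rightarrow> bool" where
  "family_basis I f S \<longleftrightarrow> inj_on f I \<and> independent (f ` I) \<and> span (f ` I) = S"

definition orthogonal_eigenbasis ::
  "'v::finite set set \<Rightarrow> real \<Rightarrow> nat \<Rightarrow> (nat \<Rightarrow> real ^ ('v config)) \<Rightarrow> bool" where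
  "orthogonal_eigenbasis E \<alpha> l \<psi> \<longleftrightarrow>
     (let I = {1..CARD('v) choose l} in
       family_basis I \<psi> (level_fun l) \<and>
       (\<forall>i\<in>I. \<exists>\<mu>. sep_eigenvector E \<alpha> l \<mu> (\<psi> i)) \<and>
       (\<forall>i\<in>I. \<forall>j\<in>I. i \<noteq> j \<longrightarrow> level_inner l (\<psi> i) (\<psi> j) = 0))"

definition ordered_eigenbasis ::
  "'v::finite set set \<Rightarrow> real \<Rightarrow> nat \<Rightarrow> (nat \<Rightarrow> real ^ ('v config)) \<Rightarrow> (nat \<Rightarrow> real) \<Rightarrow> bool" where
  "ordered_eigenbasis E \<alpha> l \<psi> \<mu> \<longleftrightarrow>
     (let N = CARD('v) choose l in
       family_basis {1..N} \<psi> (level_fun l) \<and>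
       (\<forall>i\<in>{1..N}. sep_eigenvector E \<alpha> l (\<mu> i) (\<psi> i)) \<and>
       (\<forall>i\<in>{1..N}. \<forall>j\<in>{1..N}. level_inner l (\<psi> i) (\<psi> j) = (if i = j then 1 else 0)) \<and>
       \<mu> 1 = 0 \<and> (2 \<le> N \<longrightarrow> \<mu> 1 < \<mu> 2) \<and> mono_on {1..N} \<mu>)"

text \<open>
  No restriction to a level is needed in the next two definitions: if \<open>\<psi>\<close> vanishes outside
  \<^term>\<open>level l\<close>, then \<open>psi_plus \<psi>\<close> is nonzero only at configurations \<open>x\<close> with
  \<open>ones x + 1 = l\<close>, and \<open>psi_minus \<psi>\<close> only at those with \<open>ones x = l + 1\<close>.
\<close>

definition psi_plus :: "real ^ ('v::finite config) \<Rightarrow> real ^ ('v config)" where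
  "psi_plus \<psi> = (\<chi> x. \<Sum>v | \<not> x v. \<psi> $ flip_at v x)"

definition psi_minus :: "real ^ ('v::finite config) \<Rightarrow> real ^ ('v config)" where
  "psi_minus \<psi> = (\<chi> x. \<Sum>v | x v. \<psi> $ flip_at v x)"

end

theory Submission
  imports Defs "HOL-Library.Multiset"
begin

text \<open>
  Write \<open>U\<close> for \<^const>\<open>psi_minus\<close>, \<open>D\<close> for \<^const>\<open>psi_plus\<close> and \<open>h l = l (n - l + 1)\<close>. The operators \<open>U\<close> and \<open>D\<close>
  are mutually adjoint, and on the functions on level \<open>l\<close> one has \<open>-Q = \<alpha> (h l - U D)\<close> and
  \<open>D U = U D + (n - 2 l)\<close>. Hence \<open>U\<close> and \<open>D\<close> map eigenvectors to eigenvectors with the same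
  eigenvalue \<open>\<alpha> t\<close>, and \<open>D U = h (l + 1) - t\<close> on the eigenspace. For \<open>2 l < n\<close> this makes \<open>U\<close>
  injective, and an eigenbasis of level \<open>l\<close> extends to one of level \<open>l + 1\<close> by the kernel of \<open>D\<close>,
  the orthogonal complement of the range of \<open>U\<close>, on which \<open>-Q = \<alpha> h (l + 1)\<close>. As \<open>h\<close> increases
  up to \<open>n / 2\<close>, the new eigenvalue is the largest one, so the ordering is kept. An iterate of \<open>U\<close>
  is a multiple of the sum over subconfigurations.
\<close>

subsection \<open>The raising and lowering operators\<close>

lemma ones_eq_card: "ones x = card {v. x v}"
  by (simp add: ones_def sum.If_cases of_bool_def)

lemma card_white:
  "real (card {v. \<not> x v}) = real CARD('v) - real (ones (x :: 'v::finite config))"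
proof -
  have "{v. \<not> x v} = UNIV - {v. x v}" by auto
  then show ?thesis
    by (simp add: ones_eq_card card_Diff_subset card_mono)
qed

lemma card_level: "card (level l :: 'v::finite config set) = CARD('v) choose l"
proof -
  have "bij_betw Collect (level l :: 'v config set) {A. A \<subseteq> UNIV \<and> card A = l}"
    by (rule bij_betwI[where g = "\<lambda>A v. v \<in> A"]) (auto simp: level_def ones_eq_card)
  then show ?thesis
    using n_subsets[of "UNIV :: 'v set" l] by (simp add: bij_betw_same_card)
qed

lemma flip_at_flip_at [simp]: "flip_at v (flip_at v x) = x"
  by (auto simp: flip_at_def)

lemma flip_at_commute: "flip_at v (flip_at w x) = flip_at w (flip_at v x)"
  by (auto simp: flip_at_def fun_eq_iff)

lemma flip_at_apply: "flip_at v x w = (if w = v then \<not> x v else x w)"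
  by (simp add: flip_at_def)

lemma ones_flip_at_black: "x v \<Longrightarrow> Suc (ones (flip_at v x)) = ones x"
proof -
  assume "x v"
  then have "{w. flip_at v x w} = {w. x w} - {v}"
    by (auto simp: flip_at_apply)
  moreover have "Suc (card ({w. x w} - {v})) = card {w. x w}"
    using \<open>x v\<close> by (intro card_Suc_Diff1) auto
  ultimately show ?thesis
    by (simp add: ones_eq_card)
qed

lemma ones_flip_at_white: "\<not> x v \<Longrightarrow> ones (flip_at v x) = Suc (ones x)"
  using ones_flip_at_black[of "flip_at v x" v] by (simp add: flip_at_apply)

lemma subspace_level_fun: "subspace (level_fun l)"
  by (simp add: subspace_def level_fun_def)

lemma dim_level_fun: "dim (level_fun l :: (real ^ ('v::finite config)) set) = CARD('v) choose l"
  using trans[OF dim_vec_eq[symmetric] dim_substandard_cart[of "level l :: 'v config set"]]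
  by (simp add: level_fun_def card_level)

lemma level_fun_nth_eq_0: "f \<in> level_fun l \<Longrightarrow> ones x \<noteq> l \<Longrightarrow> f $ x = 0"
  by (simp add: level_fun_def level_def)

lemma level_funI: "(\<And>x. ones x \<noteq> l \<Longrightarrow> f $ x = 0) \<Longrightarrow> f \<in> level_fun l"
  by (simp add: level_fun_def level_def)

lemma psi_minus_level_fun:
  fixes f :: "real ^ ('v::finite config)"
  assumes "f \<in> level_fun l"
  shows "psi_minus f \<in> level_fun (Suc l)"
proof (rule level_funI)
  fix x :: "'v config" assume x: "ones x \<noteq> Suc l"
  have "f $ flip_at v x = 0" if "x v" for v
    using x ones_flip_at_black[of x, OF that] by (intro level_fun_nth_eq_0[OF assms]) simp
  then show "psi_minus f $ x = 0"
    by (simp add: psi_minus_def)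
qed

lemma psi_plus_level_fun:
  fixes f :: "real ^ ('v::finite config)"
  assumes "f \<in> level_fun (Suc l)"
  shows "psi_plus f \<in> level_fun l"
proof (rule level_funI)
  fix x :: "'v config" assume x: "ones x \<noteq> l"
  have "f $ flip_at v x = 0" if "\<not> x v" for v
    using x that by (intro level_fun_nth_eq_0[OF assms]) (simp add: ones_flip_at_white)
  then show "psi_plus f $ x = 0"
    by (simp add: psi_plus_def)
qed

lemma psi_plus_level_fun_0:
  fixes f :: "real ^ ('v::finite config)"
  assumes "f \<in> level_fun 0"
  shows "psi_plus f = 0"
proof -
  have "f $ flip_at v x = 0" if "\<not> x v" for v and x :: "'v config"
    using that by (intro level_fun_nth_eq_0[OF assms]) (simp add: ones_flip_at_white)
  then show ?thesis
    by (simp add: psi_plus_def vec_eq_iff)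
qed

lemma linear_psi_plus: "linear psi_plus"
  by (rule linearI) (simp_all add: psi_plus_def vec_eq_iff sum.distrib sum_distrib_left)

lemma linear_psi_minus: "linear psi_minus"
  by (rule linearI) (simp_all add: psi_minus_def vec_eq_iff sum.distrib sum_distrib_left)

lemma psi_plus_0 [simp]: "psi_plus 0 = 0"
  by (rule linear_0[OF linear_psi_plus])

lemma psi_minus_0 [simp]: "psi_minus 0 = 0"
  by (rule linear_0[OF linear_psi_minus])

lemmas psi_plus_scaleR = linear_scale[OF linear_psi_plus]
lemmas psi_minus_scaleR = linear_scale[OF linear_psi_minus]

lemma psi_minus_psi_plus_level_fun:
  assumes "f \<in> level_fun l"
  shows "psi_minus (psi_plus f) \<in> level_fun l"
proof (cases l)
  case 0
  then show ?thesis
    using assms psi_plus_level_fun_0[of f] by (simp add: level_fun_def)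
next
  case (Suc k)
  then show ?thesis
    using psi_minus_level_fun[OF psi_plus_level_fun, of f k] assms by simp
qed

text \<open>Flipping at \<open>v\<close> is an involution exchanging the configurations black at
  \<open>v\<close> with those white at \<open>v\<close>, so the double sums agree vertex by
  vertex.\<close>

lemma psi_minus_adjoint: "psi_minus f \<bullet> g = f \<bullet> psi_plus g"
proof -
  have "psi_minus f \<bullet> g = (\<Sum>v\<in>UNIV. \<Sum>x | x v. f $ flip_at v x * g $ x)"
    using sum.swap_restrict[of UNIV UNIV "\<lambda>x v. f $ flip_at v x * g $ x" "\<lambda>x v. x v"]
    by (simp add: inner_vec_def psi_minus_def sum_distrib_right)
  also have "\<dots> = (\<Sum>v\<in>UNIV. \<Sum>x | \<not> x v. f $ x * g $ flip_at v x)"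
  proof (rule sum.cong[OF refl])
    fix v
    show "(\<Sum>x | x v. f $ flip_at v x * g $ x) = (\<Sum>x | \<not> x v. f $ x * g $ flip_at v x)"
      by (rule sum.reindex_bij_witness[where i = "flip_at v" and j = "flip_at v"])
         (auto simp: flip_at_apply)
  qed
  also have "\<dots> = f \<bullet> psi_plus g"
    using sum.swap_restrict[of UNIV UNIV "\<lambda>x v. f $ x * g $ flip_at v x" "\<lambda>x v. \<not> x v"]
    by (simp add: inner_vec_def psi_plus_def sum_distrib_left)
  finally show ?thesis .
qed

text \<open>Emptying \<open>v\<close> and filling \<open>w\<close> restores \<open>x\<close> if
  \<open>w = v\<close>, once per black vertex, and otherwise moves a marble to a white vertex.
  Filling first yields the same moves but restores \<open>x\<close> once per white vertex.\<close>

lemma psi_minus_psi_plus_nth: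
  "psi_minus (psi_plus f) $ x =
     ones x * f $ x + (\<Sum>v | x v. \<Sum>w | \<not> x w. f $ flip_at w (flip_at v x))"
proof -
  have "(\<Sum>w | \<not> flip_at v x w. f $ flip_at w (flip_at v x)) =
      f $ x + (\<Sum>w | \<not> x w. f $ flip_at w (flip_at v x))" if "x v" for v
  proof -
    have "{w. \<not> flip_at v x w} = insert v {w. \<not> x w}"
      using that by (auto simp: flip_at_apply)
    then show ?thesis using that by simp
  qed
  then show ?thesis
    by (simp add: psi_minus_def psi_plus_def sum.distrib ones_eq_card)
qed

lemma psi_plus_psi_minus_nth:
  fixes x :: "'v::finite config"
  shows "psi_plus (psi_minus f) $ x =
     (real CARD('v) - ones x) * f $ x + (\<Sum>v | x v. \<Sum>w | \<not> x w. f $ flip_at w (flip_at v x))"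
proof -
  have "(\<Sum>v | flip_at w x v. f $ flip_at v (flip_at w x)) =
      f $ x + (\<Sum>v | x v. f $ flip_at w (flip_at v x))" if "\<not> x w" for w
  proof -
    have "{v. flip_at w x v} = insert w {v. x v}"
      using that by (auto simp: flip_at_apply)
    then show ?thesis using that by (simp add: flip_at_commute[of _ w])
  qed
  then show ?thesis
    by (simp add: card_white psi_minus_def psi_plus_def sum.distrib) (rule sum.swap)
qed

text \<open>The moves cancel in the difference, which leaves \<open>f\<close> times the number of
  white minus black vertices.\<close>

lemma psi_plus_psi_minus:
  assumes "f \<in> level_fun l"
  shows "psi_plus (psi_minus f) =
    psi_minus (psi_plus f) + (real CARD('v) - 2 * real l) *\<^sub>R (f :: real ^ ('v::finite config))"
proof -
  have "psi_plus (psi_minus f) $ x =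
      psi_minus (psi_plus f) $ x + (real CARD('v) - 2 * real l) * f $ x" for x
  \<comment> \<open>Off level \<open>l\<close> the count \<open>ones x\<close> differs from
    \<open>l\<close>, but the diagonal terms vanish there together with
    \<open>f $ x\<close>.\<close>
  proof (cases "f $ x = 0")
    case False
    then have "ones x = l"
      using assms by (auto simp: level_fun_def level_def)
    then show ?thesis
      by (simp add: psi_plus_psi_minus_nth psi_minus_psi_plus_nth left_diff_distrib)
  qed (simp add: psi_plus_psi_minus_nth psi_minus_psi_plus_nth)
  then show ?thesis
    by (simp add: vec_eq_iff)
qed

section \<open>The generator on the complete graph in terms of raising and lowering\<close>

lemma swap_edge_same: "x v = x w \<Longrightarrow> v \<noteq> w \<Longrightarrow> swap_edge {v, w} x = x"
  by (auto simp: swap_edge_def fun_eq_iff insert_Diff_if)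

lemma swap_edge_distinct: "x v \<Longrightarrow> \<not> x w \<Longrightarrow> swap_edge {v, w} x = flip_at w (flip_at v x)"
  by (auto simp: swap_edge_def fun_eq_iff flip_at_def insert_Diff_if)

text \<open>An edge with equally coloured endpoints contributes nothing; any other has exactly one
  orientation from black to white.\<close>

lemma sum_complete_edges_swap:
  fixes f :: "real ^ ('v::finite config)"
  shows "(\<Sum>e\<in>complete_edges. f $ swap_edge e x - f $ x) =
     (\<Sum>v | x v. \<Sum>w | \<not> x w. f $ flip_at w (flip_at v x) - f $ x)"
proof -
  let ?P = "{v. x v} \<times> {w. \<not> x w}" and ?e = "\<lambda>(v, w). {v, w}"
  have inj: "inj_on ?e ?P"
    by (auto simp: inj_on_def doubleton_eq_iff)
  have "?e ` ?P \<subseteq> complete_edges"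
    by (auto simp: complete_edges_def card_insert_if)
  moreover have "f $ swap_edge e x - f $ x = 0" if "e \<in> complete_edges - ?e ` ?P" for e
  proof -
    have "card e = 2"
      using that by (simp add: complete_edges_def)
    then obtain v w where e: "e = {v, w}" "v \<noteq> w"
      by (auto simp: card_2_iff)
    have "?e (v, w) = e" "?e (w, v) = e"
      using e by auto
    then have "(v, w) \<notin> ?P" "(w, v) \<notin> ?P"
      using that by blast+
    then have "x v = x w"
      by blast
    then show ?thesis
      using swap_edge_same[OF _ e(2), of x] by (simp add: e(1))
  qed
  ultimately have "(\<Sum>e\<in>complete_edges. f $ swap_edge e x - f $ x) =
      (\<Sum>e\<in>?e ` ?P. f $ swap_edge e x - f $ x)"
    by (intro sum.mono_neutral_right) auto
  also have "\<dots> = (\<Sum>p\<in>?P. f $ swap_edge (?e p) x - f $ x)"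
    using sum.reindex[OF inj] by (simp only: o_def)
  also have "\<dots> = (\<Sum>(v, w)\<in>?P. f $ flip_at w (flip_at v x) - f $ x)"
    by (intro sum.cong) (auto simp: swap_edge_distinct)
  finally show ?thesis
    by (simp add: sum.cartesian_product)
qed

text \<open>For \<open>l\<close> \<le> \<open>k\<close> and \<open>2 * k\<close> \<le>
  \<open>n\<close> these are the Laplacian eigenvalues of the Johnson graph on level
  \<open>k\<close>, whose edges move one marble. They do not involve \<open>k\<close>, so a level
  inherits the spectrum of the levels below.\<close>

definition johnson_eigenvalue :: "nat \<Rightarrow> nat \<Rightarrow> real" where
  "johnson_eigenvalue n l = real l * (real n - real l + 1)"

lemma johnson_eigenvalue_strict_mono:
  assumes "j < k" "2 * k \<le> n"
  shows "johnson_eigenvalue n j < johnson_eigenvalue n k"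
proof -
  have "johnson_eigenvalue n k - johnson_eigenvalue n j = (real k - real j) * (real n + 1 - real j - real k)"
    by (simp add: johnson_eigenvalue_def algebra_simps)
  also have "\<dots> > 0"
    using assms by (intro mult_pos_pos) auto
  finally show ?thesis by simp
qed

text \<open>With \<open>n\<close> vertices, a configuration on level \<open>l\<close> has
  \<open>l * (n - l)\<close> moves. The sum of \<open>f\<close> over the moves is
  \<open>psi_minus (psi_plus f)\<close> less its diagonal part \<open>l * f\<close>, which turns
  \<open>l * (n - l)\<close> into \<open>l * (n - l + 1)\<close>.\<close>

lemma sep_generator_complete:
  fixes f :: "real ^ ('v::finite config)"
  assumes "f \<in> level_fun l"
  shows "- sep_generator complete_edges \<alpha> l f =
    \<alpha> *\<^sub>R (johnson_eigenvalue CARD('v) l *\<^sub>R f - psi_minus (psi_plus f))"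
proof (subst vec_eq_iff, rule allI)
  fix x
  show "(- sep_generator complete_edges \<alpha> l f) $ x =
    (\<alpha> *\<^sub>R (johnson_eigenvalue CARD('v) l *\<^sub>R f - psi_minus (psi_plus f))) $ x"
  proof (cases "x \<in> level l")
    case True
    then have l: "ones x = l"
      by (simp add: level_def)
    then have c: "card {v. x v} = l"
      by (simp add: ones_eq_card)
    define S where "S = (\<Sum>v | x v. \<Sum>w | \<not> x w. f $ flip_at w (flip_at v x))"
    have "sep_generator complete_edges \<alpha> l f $ x =
        \<alpha> * (\<Sum>e\<in>complete_edges. f $ swap_edge e x - f $ x)"
      using True by (simp add: sep_generator_def)
    moreover have "(\<Sum>e\<in>complete_edges. f $ swap_edge e x - f $ x) =
        S - real l * (real CARD('v) - real l) * f $ x"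
      unfolding sum_complete_edges_swap S_def
      by (simp add: sum_subtractf card_white l c)
    moreover have "psi_minus (psi_plus f) $ x = real l * f $ x + S"
      by (simp add: psi_minus_psi_plus_nth l S_def)
    ultimately show ?thesis
      by (simp add: johnson_eigenvalue_def) (simp only: algebra_simps)
  next
    case False
    moreover have "f $ x = 0" "psi_minus (psi_plus f) $ x = 0"
      using False assms psi_minus_psi_plus_level_fun[OF assms]
      unfolding level_fun_def by blast+
    ultimately show ?thesis
      by (simp add: sep_generator_def)
  qed
qed

section \<open>Eigenspaces and their passage between levels\<close>

lemma sep_eigenspace_iff:
  fixes f :: "real ^ ('v::finite config)"
  assumes "\<alpha> > 0"
  shows "f \<in> sep_eigenspace complete_edges \<alpha> l (\<alpha> * t) \<longleftrightarrow>
    f \<in> level_fun l \<and> psi_minus (psi_plus f) = (johnson_eigenvalue CARD('v) l - t) *\<^sub>R f"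
proof (cases "f \<in> level_fun l")
  case True
  have "\<alpha> *\<^sub>R (johnson_eigenvalue CARD('v) l *\<^sub>R f - psi_minus (psi_plus f)) = (\<alpha> * t) *\<^sub>R f \<longleftrightarrow>
    johnson_eigenvalue CARD('v) l *\<^sub>R f - psi_minus (psi_plus f) = t *\<^sub>R f"
    using assms by (metis scaleR_scaleR scaleR_left_imp_eq less_irrefl)
  also have "\<dots> \<longleftrightarrow> psi_minus (psi_plus f) = (johnson_eigenvalue CARD('v) l - t) *\<^sub>R f"
    by (auto simp: algebra_simps)
  finally show ?thesis
    using True by (simp add: sep_eigenspace_def sep_generator_complete)
qed (simp add: sep_eigenspace_def)

text \<open>The commutation term \<open>n - 2 * l\<close> is exactly the increment of
  \<open>johnson_eigenvalue n\<close> from \<open>l\<close> to \<open>Suc l\<close>.\<close>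

lemma psi_plus_psi_minus_eigen:
  fixes f :: "real ^ ('v::finite config)"
  assumes "\<alpha> > 0" "f \<in> sep_eigenspace complete_edges \<alpha> l (\<alpha> * t)"
  shows "psi_plus (psi_minus f) = (johnson_eigenvalue CARD('v) (Suc l) - t) *\<^sub>R f"
proof -
  have f: "f \<in> level_fun l" "psi_minus (psi_plus f) = (johnson_eigenvalue CARD('v) l - t) *\<^sub>R f"
    using assms by (simp_all add: sep_eigenspace_iff)
  have "johnson_eigenvalue CARD('v) l + (real CARD('v) - 2 * real l) = johnson_eigenvalue CARD('v) (Suc l)"
    by (simp add: johnson_eigenvalue_def algebra_simps)
  then show ?thesis
    unfolding psi_plus_psi_minus[OF f(1)] f(2) by (metis scaleR_left_distrib add_diff_eq add.commute)
qed

lemma psi_minus_eigenspace: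
  fixes f :: "real ^ ('v::finite config)"
  assumes "\<alpha> > 0" "f \<in> sep_eigenspace complete_edges \<alpha> l (\<alpha> * t)"
  shows "psi_minus f \<in> sep_eigenspace complete_edges \<alpha> (Suc l) (\<alpha> * t)"
  using assms psi_plus_psi_minus_eigen[OF assms]
  by (simp add: sep_eigenspace_iff psi_minus_level_fun psi_minus_scaleR)

text \<open>Apply \<open>psi_plus\<close> to the eigenvector equation and commute. This costs
  \<open>n - 2 * l\<close>, the same increment as before, so \<open>t\<close> is preserved.\<close>

lemma psi_plus_eigenspace:
  fixes f :: "real ^ ('v::finite config)"
  assumes "\<alpha> > 0" "f \<in> sep_eigenspace complete_edges \<alpha> (Suc l) (\<alpha> * t)"
  shows "psi_plus f \<in> sep_eigenspace complete_edges \<alpha> l (\<alpha> * t)"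
proof -
  let ?h = "johnson_eigenvalue CARD('v)"
  have f: "f \<in> level_fun (Suc l)" "psi_minus (psi_plus f) = (?h (Suc l) - t) *\<^sub>R f"
    using assms by (simp_all add: sep_eigenspace_iff)
  have g: "psi_plus f \<in> level_fun l"
    using f(1) by (rule psi_plus_level_fun)
  have h: "?h (Suc l) - t - (real CARD('v) - 2 * real l) = ?h l - t"
    by (simp add: johnson_eigenvalue_def algebra_simps)
  have "psi_minus (psi_plus (psi_plus f)) =
      psi_plus (psi_minus (psi_plus f)) - (real CARD('v) - 2 * real l) *\<^sub>R psi_plus f"
    using psi_plus_psi_minus[OF g] by simp
  also have "\<dots> = (?h l - t) *\<^sub>R psi_plus f"
    unfolding f(2) psi_plus_scaleR h[symmetric] by (rule scaleR_left_diff_distrib[symmetric])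
  finally show ?thesis
    using assms(1) g by (simp add: sep_eigenspace_iff)
qed

text \<open>\<open>psi_minus\<close> after \<open>psi_plus\<close> is self-adjoint, being an
  operator composed with its adjoint.\<close>

lemma eigenspaces_orthogonal:
  fixes f g :: "real ^ ('v::finite config)"
  assumes "\<alpha> > 0" "s \<noteq> t"
    and f: "f \<in> sep_eigenspace complete_edges \<alpha> l s"
    and g: "g \<in> sep_eigenspace complete_edges \<alpha> l t"
  shows "f \<bullet> g = 0"
proof -
  let ?h = "johnson_eigenvalue CARD('v) l"
  have "psi_minus (psi_plus f) = (?h - s / \<alpha>) *\<^sub>R f" "psi_minus (psi_plus g) = (?h - t / \<alpha>) *\<^sub>R g"
    using sep_eigenspace_iff[OF \<open>\<alpha> > 0\<close>, of f l "s / \<alpha>"] sep_eigenspace_iff[OF \<open>\<alpha> > 0\<close>, of g l "t / \<alpha>"]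
      f g \<open>\<alpha> > 0\<close> by simp_all
  moreover have "psi_minus (psi_plus f) \<bullet> g = f \<bullet> psi_minus (psi_plus g)"
    by (metis inner_commute psi_minus_adjoint)
  ultimately have "(?h - s / \<alpha>) * (f \<bullet> g) = (?h - t / \<alpha>) * (f \<bullet> g)"
    by (metis inner_scaleR_left inner_scaleR_right)
  then show ?thesis
    using assms(1,2) by simp
qed

lemma subspace_sep_eigenspace:
  assumes "\<alpha> > 0"
  shows "subspace (sep_eigenspace (complete_edges :: 'v::finite set set) \<alpha> l t)"
proof -
  have "sep_eigenspace (complete_edges :: 'v set set) \<alpha> l t = {f \<in> level_fun l.
      psi_minus (psi_plus f) = (johnson_eigenvalue CARD('v) l - t / \<alpha>) *\<^sub>R f}"
    using sep_eigenspace_iff[OF assms, of _ l "t / \<alpha>"] assms by auto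
  then show ?thesis
    using subspace_level_fun[of l]
    by (auto simp: subspace_def psi_plus_scaleR psi_minus_scaleR scaleR_right_distrib
        linear_add[OF linear_psi_plus] linear_add[OF linear_psi_minus])
qed

subsection \<open>Ordered eigenbases\<close>

text \<open>Nonzero orthogonal vectors are distinct and independent, and as many of them as the
  dimension must span.\<close>

lemma family_basisI_orthogonal:
  fixes f :: "nat \<Rightarrow> 'a::euclidean_space"
  assumes "finite I" "subspace S" "card I = dim S"
    and S: "\<And>i. i \<in> I \<Longrightarrow> f i \<in> S"
    and nz: "\<And>i. i \<in> I \<Longrightarrow> f i \<noteq> 0"
    and orth: "\<And>i j. i \<in> I \<Longrightarrow> j \<in> I \<Longrightarrow> i \<noteq> j \<Longrightarrow> f i \<bullet> f j = 0"
  shows "family_basis I f S"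
proof -
  have inj: "inj_on f I"
    using nz orth by (metis inj_onI inner_eq_zero_iff)
  have "pairwise orthogonal (f ` I)" "0 \<notin> f ` I"
    using orth nz by (auto simp: pairwise_def orthogonal_def)
  then have ind: "independent (f ` I)"
    by (rule pairwise_orthogonal_independent)
  have sub: "f ` I \<subseteq> S"
    using S by auto
  have "S \<subseteq> span (f ` I)"
    using card_eq_dim[OF sub] ind assms(1,3) card_image[OF inj] by simp
  moreover have "span (f ` I) \<subseteq> S"
    using sub \<open>subspace S\<close> by (rule span_minimal)
  ultimately show ?thesis
    using inj ind by (auto simp: family_basis_def)
qed

lemma level_inner_eq:
  fixes f :: "real ^ ('v::finite config)"
  assumes "f \<in> level_fun l"
  shows "level_inner l f g = inverse (real (CARD('v) choose l)) * (f \<bullet> g)"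
proof -
  have "(\<Sum>x\<in>level l. f $ x * g $ x) = (\<Sum>x\<in>UNIV. f $ x * g $ x)"
    using assms by (intro sum.mono_neutral_left) (auto simp: level_fun_def)
  then show ?thesis
    by (simp add: level_inner_def inner_vec_def)
qed

text \<open>The averaging factor in \<open>level_inner\<close> gives a normalized vector the ambient
  squared norm \<open>CARD('v) choose l\<close>; the bound on \<open>l\<close> keeps this
  nonzero.\<close>

lemma ordered_eigenbasisD:
  fixes \<phi> :: "nat \<Rightarrow> real ^ ('v::finite config)"
  assumes "ordered_eigenbasis E \<alpha> l \<phi> \<nu>" and "l \<le> CARD('v)"
    and i: "i \<in> {1..CARD('v) choose l}"
  shows "\<phi> i \<in> sep_eigenspace E \<alpha> l (\<nu> i)" "\<phi> i \<in> level_fun l"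
    and "j \<in> {1..CARD('v) choose l} \<Longrightarrow>
      \<phi> i \<bullet> \<phi> j = (if i = j then real (CARD('v) choose l) else 0)"
proof -
  show *: "\<phi> i \<in> sep_eigenspace E \<alpha> l (\<nu> i)"
    using assms by (simp add: ordered_eigenbasis_def Let_def sep_eigenvector_def)
  then show l: "\<phi> i \<in> level_fun l"
    by (simp add: sep_eigenspace_def)
  assume "j \<in> {1..CARD('v) choose l}"
  then have "level_inner l (\<phi> i) (\<phi> j) = (if i = j then 1 else 0)"
    using assms by (simp add: ordered_eigenbasis_def Let_def)
  then show "\<phi> i \<bullet> \<phi> j = (if i = j then real (CARD('v) choose l) else 0)"
    using level_inner_eq[OF l, of "\<phi> j"] \<open>l \<le> CARD('v)\<close> i
    by (auto simp: field_simps split: if_splits)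
qed

text \<open>
  Passing from level \<open>j - 1\<close> to level \<open>j\<close> adds just the eigenvalue \<open>\<alpha> j (n - j + 1)\<close>, which is the
  largest so far. So the \<open>i\<close>th eigenvalue in increasing order, at every level \<open>l\<close> with
  \<open>i \<le> n choose l\<close>, comes from the first level that has at least \<open>i\<close> configurations.
\<close>

definition eigenvalue_index :: "nat \<Rightarrow> nat \<Rightarrow> nat" where
  "eigenvalue_index n i = (LEAST j. i \<le> n choose j)"

definition johnson_spectrum :: "real \<Rightarrow> nat \<Rightarrow> nat \<Rightarrow> real" where
  "johnson_spectrum \<alpha> n i = \<alpha> * johnson_eigenvalue n (eigenvalue_index n i)"

text \<open>The first bound ensures that the least index is attained. Binomial coefficients increase
  up to \<open>n / 2\<close>, so an index that fits into one level fits into every later level up to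
  \<open>k\<close>.\<close>

lemma eigenvalue_index_le_iff:
  assumes "i \<le> n choose l" "2 * k \<le> n"
  shows "eigenvalue_index n i \<le> k \<longleftrightarrow> i \<le> n choose k"
proof
  assume k: "eigenvalue_index n i \<le> k"
  have "i \<le> n choose eigenvalue_index n i"
    unfolding eigenvalue_index_def by (rule LeastI[of "\<lambda>j. i \<le> n choose j"]) (rule assms)
  also have "\<dots> \<le> n choose k"
    using k assms(2) by (rule binomial_mono)
  finally show "i \<le> n choose k" .
qed (simp add: eigenvalue_index_def Least_le)

lemma eigenvalue_index_eq_iff:
  assumes "i \<le> n choose l" "2 * k \<le> n" "k > 0"
  shows "eigenvalue_index n i = k \<longleftrightarrow> n choose (k - 1) < i \<and> i \<le> n choose k"
proof -
  have "eigenvalue_index n i \<le> k - 1 \<longleftrightarrow> i \<le> n choose (k - 1)"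
    using assms by (intro eigenvalue_index_le_iff) auto
  moreover have "eigenvalue_index n i \<le> k \<longleftrightarrow> i \<le> n choose k"
    using assms by (intro eigenvalue_index_le_iff)
  ultimately show ?thesis
    using \<open>k > 0\<close> by linarith
qed

lemma johnson_eigenvalue_less_iff:
  assumes "2 * j \<le> n" "2 * k \<le> n"
  shows "johnson_eigenvalue n j < johnson_eigenvalue n k \<longleftrightarrow> j < k"
  using johnson_eigenvalue_strict_mono[of j k n] johnson_eigenvalue_strict_mono[of k j n] assms
  by (cases j k rule: linorder_cases) auto

text \<open>Turns the eigenvalue bound of claim (d) into an index bound, by strict monotonicity of
  \<open>johnson_eigenvalue\<close> up to \<open>n / 2\<close>.\<close>

lemma johnson_spectrum_le_iff:
  assumes "\<alpha> > 0" "i \<le> n choose l" "2 * l \<le> n" "2 * m \<le> n"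
  shows "johnson_spectrum \<alpha> n i \<le> \<alpha> * johnson_eigenvalue n m \<longleftrightarrow> i \<le> n choose m"
proof -
  have "eigenvalue_index n i \<le> l"
    using assms eigenvalue_index_le_iff by blast
  then have "johnson_eigenvalue n m < johnson_eigenvalue n (eigenvalue_index n i) \<longleftrightarrow>
      m < eigenvalue_index n i"
    using assms by (intro johnson_eigenvalue_less_iff) auto
  moreover have "eigenvalue_index n i \<le> m \<longleftrightarrow> i \<le> n choose m"
    using assms eigenvalue_index_le_iff by blast
  ultimately show ?thesis
    using \<open>\<alpha> > 0\<close> by (auto simp: johnson_spectrum_def not_less[symmetric])
qed

text \<open>Leaves only the eigenvector equations and the Gram matrix to check: orthogonality and
  the count yield a basis, and the ordering is a property of \<open>johnson_spectrum\<close>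
  alone.\<close>

lemma ordered_eigenbasisI:
  fixes \<psi> :: "nat \<Rightarrow> real ^ ('v::finite config)"
  defines "I l \<equiv> {1..CARD('v) choose l}"
  assumes "\<alpha> > 0" and l: "2 * l \<le> CARD('v)"
    and eig: "\<And>i. i \<in> I l \<Longrightarrow>
      \<psi> i \<in> sep_eigenspace complete_edges \<alpha> l (johnson_spectrum \<alpha> CARD('v) i)"
    and orth: "\<And>i j. i \<in> I l \<Longrightarrow> j \<in> I l \<Longrightarrow>
      \<psi> i \<bullet> \<psi> j = (if i = j then real (CARD('v) choose l) else 0)"
  shows "ordered_eigenbasis complete_edges \<alpha> l \<psi> (johnson_spectrum \<alpha> CARD('v))"
proof -
  let ?n = "CARD('v)" and ?\<mu> = "johnson_spectrum \<alpha> CARD('v)"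
  have pos: "?n choose l > 0"
    using l by simp
  have lev: "\<psi> i \<in> level_fun l" if "i \<in> I l" for i
    using eig[OF that] by (simp add: sep_eigenspace_def)
  have nz: "\<psi> i \<noteq> 0" if "i \<in> I l" for i
    using orth[OF that that] pos by auto
  have "family_basis (I l) \<psi> (level_fun l)"
    using lev nz orth
    by (intro family_basisI_orthogonal) (auto simp: I_def subspace_level_fun dim_level_fun)
  moreover have "level_inner l (\<psi> i) (\<psi> j) = (if i = j then 1 else 0)"
    if "i \<in> I l" "j \<in> I l" for i j
    using level_inner_eq[OF lev[OF that(1)]] orth[OF that] pos by simp
  moreover have idx: "eigenvalue_index ?n i \<le> l" if "i \<in> I l" for i
    using that l eigenvalue_index_le_iff[of i ?n l l] by (simp add: I_def)
  moreover have "?\<mu> 1 = 0"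
    using eigenvalue_index_le_iff[of 1 ?n 0 0] by (simp add: johnson_spectrum_def johnson_eigenvalue_def)
  \<comment> \<open>Level 0 has one configuration, so the second eigenvalue comes from a positive
    level.\<close>
  moreover have "?\<mu> 1 < ?\<mu> 2" if "2 \<le> ?n choose l"
  proof -
    have "0 < eigenvalue_index ?n 2"
      using eigenvalue_index_le_iff[of 2 ?n l 0] that by simp
    moreover have "eigenvalue_index ?n 2 \<le> l"
      using idx[of 2] that by (simp add: I_def)
    ultimately have "johnson_eigenvalue ?n 0 < johnson_eigenvalue ?n (eigenvalue_index ?n 2)"
      using l by (intro johnson_eigenvalue_strict_mono) auto
    then show ?thesis
      unfolding \<open>?\<mu> 1 = 0\<close> using \<open>\<alpha> > 0\<close> by (simp add: johnson_spectrum_def johnson_eigenvalue_def)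
  qed
  moreover have "mono_on (I l) ?\<mu>"
  proof (rule mono_onI)
    fix i j assume ij: "i \<in> I l" "j \<in> I l" "i \<le> j"
    have "eigenvalue_index ?n i \<le> eigenvalue_index ?n j"
      using ij idx[OF ij(2)] l eigenvalue_index_le_iff[of j ?n l "eigenvalue_index ?n j"]
        eigenvalue_index_le_iff[of i ?n l "eigenvalue_index ?n j"] by (simp add: I_def)
    then have "\<not> johnson_eigenvalue ?n (eigenvalue_index ?n j) < johnson_eigenvalue ?n (eigenvalue_index ?n i)"
      using idx[OF ij(1)] idx[OF ij(2)] l by (subst johnson_eigenvalue_less_iff) auto
    then show "?\<mu> i \<le> ?\<mu> j"
      using \<open>\<alpha> > 0\<close> by (simp add: johnson_spectrum_def)
  qed
  ultimately show ?thesis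
    using eig nz by (simp add: ordered_eigenbasis_def Let_def sep_eigenvector_def I_def)
qed

section \<open>Multiplicities and uniqueness of the ordered eigenvalues\<close>

lemma dim_sep_eigenspace:
  fixes \<phi> :: "nat \<Rightarrow> real ^ ('v::finite config)"
  assumes "\<alpha> > 0" "l \<le> CARD('v)" and basis: "ordered_eigenbasis complete_edges \<alpha> l \<phi> \<nu>"
  shows "dim (sep_eigenspace (complete_edges :: 'v set set) \<alpha> l t) =
    card {i \<in> {1..CARD('v) choose l}. \<nu> i = t}"
proof -
  let ?I = "{1..CARD('v) choose l}" and ?W = "sep_eigenspace (complete_edges :: 'v set set) \<alpha> l t"
  define J where "J = {i \<in> ?I. \<nu> i = t}"
  note D = ordered_eigenbasisD[OF basis \<open>l \<le> CARD('v)\<close>]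
  have fb: "inj_on \<phi> ?I" "independent (\<phi> ` ?I)" "span (\<phi> ` ?I) = level_fun l"
    using basis by (simp_all add: ordered_eigenbasis_def Let_def family_basis_def)
  have "?W \<subseteq> span (\<phi> ` J)"
  proof
    fix f assume f: "f \<in> ?W"
    then have "f \<in> span (\<phi> ` ?I)"
      unfolding fb(3) by (simp add: sep_eigenspace_def)
    then obtain u where "f = (\<Sum>v\<in>\<phi> ` ?I. u v *\<^sub>R v)"
      by (auto simp: span_finite)
    then have u: "f = (\<Sum>i\<in>?I. u (\<phi> i) *\<^sub>R \<phi> i)"
      by (simp only: sum.reindex[OF fb(1)] o_def)
    \<comment> \<open>Pairing \<open>f\<close> with \<open>\<phi> i\<close> isolates this
      coefficient, and the pairing vanishes because the eigenvalues differ.\<close>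
    have "u (\<phi> i) = 0" if i: "i \<in> ?I - J" for i
    proof -
      have "f \<bullet> \<phi> i = (\<Sum>j\<in>?I. if j = i then u (\<phi> i) * real (CARD('v) choose l) else 0)"
        unfolding u inner_sum_left using i D(3)[of _ i] by (intro sum.cong) auto
      also have "\<dots> = u (\<phi> i) * real (CARD('v) choose l)"
        using i by simp
      finally have "f \<bullet> \<phi> i = u (\<phi> i) * real (CARD('v) choose l)" .
      moreover have "f \<bullet> \<phi> i = 0"
        using i D(1)[of i] f by (intro eigenspaces_orthogonal[OF \<open>\<alpha> > 0\<close>]) (auto simp: J_def)
      ultimately show ?thesis
        using \<open>l \<le> CARD('v)\<close> by simp
    qed
    then have fJ: "f = (\<Sum>i\<in>J. u (\<phi> i) *\<^sub>R \<phi> i)"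
      unfolding u by (intro sum.mono_neutral_right) (auto simp: J_def)
    show "f \<in> span (\<phi> ` J)"
      unfolding fJ by (intro span_sum span_scale span_base) auto
  qed
  moreover have "span (\<phi> ` J) \<subseteq> ?W"
    using D(1) by (intro span_minimal subspace_sep_eigenspace \<open>\<alpha> > 0\<close>) (auto simp: J_def)
  moreover have "independent (\<phi> ` J)"
    using fb(2) by (rule independent_mono) (auto simp: J_def)
  moreover have "card (\<phi> ` J) = card J"
    using fb(1) by (intro card_image inj_on_subset[OF fb(1)]) (auto simp: J_def)
  ultimately show ?thesis
    by (metis J_def dim_span_eq_card_independent subset_antisym)
qed

text \<open>Equal fibre sizes mean equal multisets of values, and a sorted list is determined by its
  multiset.\<close>

lemma mono_on_eqI_card_fibres:
  fixes \<mu> \<nu> :: "nat \<Rightarrow> 'a::linorder"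
  assumes "mono_on {1..N} \<mu>" "mono_on {1..N} \<nu>"
    and fibres: "\<And>t. card {i \<in> {1..N}. \<mu> i = t} = card {i \<in> {1..N}. \<nu> i = t}"
    and "i \<in> {1..N}"
  shows "\<mu> i = \<nu> i"
proof -
  have "count (mset (map f [1..<Suc N])) t = card {i \<in> {1..N}. f i = t}" for f :: "nat \<Rightarrow> 'a" and t
  proof -
    have "f -` {t} \<inter> {1..N} = {i \<in> {1..N}. f i = t}"
      by auto
    then show ?thesis
      by (simp add: count_image_mset atLeastLessThanSuc_atLeastAtMost del: upt_Suc)
  qed
  then have "mset (map \<mu> [1..<Suc N]) = mset (map \<nu> [1..<Suc N])"
    by (intro multiset_eqI) (simp only: fibres)
  moreover have "sorted (map f [1..<Suc N])" if "mono_on {1..N} f" for f :: "nat \<Rightarrow> 'a"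
    unfolding sorted_iff_nth_mono
    using monotone_onD[OF that] by (auto simp: nth_upt simp del: upt_Suc)
  ultimately have "map \<mu> [1..<Suc N] = map \<nu> [1..<Suc N]"
    using assms(1,2) by (metis properties_for_sort sorted_sort_id)
  then show ?thesis
    using assms(4) by (simp del: upt_Suc)
qed

text \<open>The number of indices carrying a given value is the dimension of an eigenspace, which
  does not refer to the basis.\<close>

lemma ordered_eigenbasis_eigenvalues_unique:
  fixes \<phi> \<psi> :: "nat \<Rightarrow> real ^ ('v::finite config)"
  assumes "\<alpha> > 0" "l \<le> CARD('v)"
    and "ordered_eigenbasis complete_edges \<alpha> l \<phi> \<nu>" "ordered_eigenbasis complete_edges \<alpha> l \<psi> \<mu>"
    and "i \<in> {1..CARD('v) choose l}"
  shows "\<nu> i = \<mu> i"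
proof (rule mono_on_eqI_card_fibres)
  show "mono_on {1..CARD('v) choose l} \<nu>" "mono_on {1..CARD('v) choose l} \<mu>"
    using assms(3,4) by (simp_all add: ordered_eigenbasis_def Let_def)
  show "card {i \<in> {1..CARD('v) choose l}. \<nu> i = t} = card {i \<in> {1..CARD('v) choose l}. \<mu> i = t}" for t
    using dim_sep_eigenspace[OF assms(1-3)] dim_sep_eigenspace[OF assms(1,2,4)] by simp
qed (rule assms(5))

section \<open>Extending an eigenbasis to the next level\<close>

lemma inj_on_psi_minus:
  assumes "2 * l < CARD('v)"
  shows "inj_on psi_minus (level_fun l :: (real ^ ('v::finite config)) set)"
proof -
  have "f = 0" if f: "f \<in> level_fun l" "psi_minus f = 0" for f :: "real ^ ('v config)"
  proof -
    \<comment> \<open>Pairing \<open>psi_plus (psi_minus f) = 0\<close> with \<open>f\<close> yields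
      the squared norm of \<open>psi_plus f\<close> plus a positive multiple of that of
      \<open>f\<close>, so \<open>f\<close> vanishes.\<close>
    have "f \<bullet> psi_minus (psi_plus f) = psi_plus f \<bullet> psi_plus f"
      by (subst inner_commute) (rule psi_minus_adjoint)
    then have UD: "f \<bullet> psi_plus (psi_minus f) =
        psi_plus f \<bullet> psi_plus f + (real CARD('v) - 2 * real l) * (f \<bullet> f)"
      by (simp add: psi_plus_psi_minus[OF f(1)] inner_add_right)
    have "0 = f \<bullet> psi_plus (psi_minus f)"
      using f by simp
    also have "\<dots> = psi_plus f \<bullet> psi_plus f + (real CARD('v) - 2 * real l) * (f \<bullet> f)"
      by (rule UD)
    finally have "(real CARD('v) - 2 * real l) * (f \<bullet> f) \<le> 0"
      using inner_ge_zero[of "psi_plus f"] by linarith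
    then have "f \<bullet> f \<le> 0"
      using assms by (simp add: mult_le_0_iff)
    then show "f = 0"
      by (metis inner_eq_zero_iff inner_ge_zero order_antisym)
  qed
  then show ?thesis
    using linear_inj_on_iff_eq_0[OF linear_psi_minus subspace_level_fun] by blast
qed

text \<open>By adjointness the kernel is the orthogonal complement, within level
  \<open>Suc l\<close>, of the range of \<open>psi_minus\<close>, whose dimension is known by
  injectivity.\<close>

lemma dim_psi_plus_kernel:
  assumes "2 * l < CARD('v)"
  shows "dim {f \<in> level_fun (Suc l) :: (real ^ ('v::finite config)) set. psi_plus f = 0} +
    (CARD('v) choose l) = CARD('v) choose Suc l"
proof -
  let ?A = "psi_minus ` (level_fun l :: (real ^ ('v config)) set)"
  have "{f \<in> level_fun (Suc l). psi_plus f = 0} = {f \<in> level_fun (Suc l). \<forall>g\<in>?A. orthogonal g f}"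
  proof -
    have "psi_plus f = 0 \<longleftrightarrow> (\<forall>g\<in>?A. orthogonal g f)"
      if "f \<in> level_fun (Suc l)" for f :: "real ^ ('v config)"
    proof
      assume "\<forall>g\<in>?A. orthogonal g f"
      \<comment> \<open>Testing against this element of the range produces the squared norm of
        \<open>psi_plus f\<close>.\<close>
      then have "psi_minus (psi_plus f) \<bullet> f = 0"
        using psi_plus_level_fun[OF that] by (simp add: orthogonal_def)
      then show "psi_plus f = 0"
        by (simp add: psi_minus_adjoint)
    qed (simp add: orthogonal_def psi_minus_adjoint)
    then show ?thesis by auto
  qed
  moreover have "dim ?A = CARD('v) choose l"
    using dim_image_eq[OF linear_psi_minus, of "level_fun l"] inj_on_psi_minus[OF assms]
    by (simp add: span_eq_iff[THEN iffD2, OF subspace_level_fun] dim_level_fun)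
  moreover have "dim {f \<in> level_fun (Suc l). \<forall>g\<in>?A. orthogonal g f} + dim ?A =
      dim (level_fun (Suc l) :: (real ^ ('v config)) set)"
    by (rule dim_subspace_orthogonal_to_vectors)
       (auto simp: linear_subspace_image[OF linear_psi_minus] subspace_level_fun psi_minus_level_fun)
  ultimately show ?thesis
    by (simp add: dim_level_fun)
qed

text \<open>By adjointness, \<open>psi_minus\<close> multiplies the squared norm of the
  \<open>i\<close>th eigenvector by the difference of eigenvalues in the denominator. The constant
  rescales the result from \<open>n choose l\<close> times this factor to the norm required on level
  \<open>Suc l\<close>.\<close>

definition raising_constant :: "nat \<Rightarrow> nat \<Rightarrow> nat \<Rightarrow> real" where
  "raising_constant n l i = sqrt (real (n choose Suc l) / (real (n choose l) *
     (johnson_eigenvalue n (Suc l) - johnson_eigenvalue n (eigenvalue_index n i))))"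

lemma johnson_eigenvalue_index_less:
  assumes "2 * Suc l \<le> n" "i \<le> n choose l"
  shows "johnson_eigenvalue n (eigenvalue_index n i) < johnson_eigenvalue n (Suc l)"
proof -
  have "eigenvalue_index n i \<le> l"
    using assms eigenvalue_index_le_iff[of i n l l] by simp
  then show ?thesis
    using assms by (intro johnson_eigenvalue_strict_mono) auto
qed

lemma raising_constant_pos:
  assumes "2 * Suc l \<le> n" "i \<le> n choose l"
  shows "raising_constant n l i > 0"
  using johnson_eigenvalue_index_less[OF assms] assms(1) by (simp add: raising_constant_def)

text \<open>Raised eigenvectors fill the indices up to \<open>CARD('v) choose l\<close>; an
  orthonormal basis of the kernel of \<open>psi_plus\<close> fills the rest.\<close>

lemma extend_ordered_eigenbasis:
  fixes \<phi> :: "nat \<Rightarrow> real ^ ('v::finite config)"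
  assumes "\<alpha> > 0" and l: "2 * Suc l \<le> CARD('v)"
    and basis: "ordered_eigenbasis complete_edges \<alpha> l \<phi> \<nu>"
    and \<nu>: "\<And>i. i \<in> {1..CARD('v) choose l} \<Longrightarrow> \<nu> i = johnson_spectrum \<alpha> CARD('v) i"
  obtains \<psi> where
    "ordered_eigenbasis complete_edges \<alpha> (Suc l) \<psi> (johnson_spectrum \<alpha> CARD('v))"
    "\<And>i. i \<in> {1..CARD('v) choose l} \<Longrightarrow>
      \<psi> i = raising_constant CARD('v) l i *\<^sub>R psi_minus (\<phi> i)"
proof -
  define n where "n = CARD('v)"
  define M N where "M = n choose l" and "N = n choose Suc l"
  let ?W = "{f \<in> level_fun (Suc l) :: (real ^ ('v config)) set. psi_plus f = 0}"
  let ?h = "johnson_eigenvalue n" and ?c = "raising_constant n l" and ?\<mu> = "johnson_spectrum \<alpha> n"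
  have MN: "0 < M" "M \<le> N"
    using l binomial_mono[of l "Suc l" n] by (simp_all add: M_def N_def n_def)
  note D = ordered_eigenbasisD[OF basis, folded n_def, folded M_def]
  have ln: "l \<le> n"
    using l by (simp add: n_def)
  have eig: "\<phi> i \<in> sep_eigenspace complete_edges \<alpha> l (\<alpha> * ?h (eigenvalue_index n i))"
    if "i \<in> {1..M}" for i
    using D(1)[OF ln that] \<nu>[of i] that by (simp add: johnson_spectrum_def n_def M_def)
  have "subspace ?W"
    using subspace_level_fun[of "Suc l"]
    by (auto simp: subspace_def psi_plus_scaleR linear_add[OF linear_psi_plus])
  then obtain B where B: "B \<subseteq> ?W" "pairwise orthogonal B" "\<And>f. f \<in> B \<Longrightarrow> norm f = 1"
      "independent B" "card B = dim ?W"
    by (rule orthonormal_basis_subspace) blast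
  have "card B = card {M<..N}"
    using B(5) dim_psi_plus_kernel[of l, where 'v = 'v] l by (simp add: M_def N_def n_def)
  then obtain b where b: "bij_betw b {M<..N} B"
    using finite_same_card_bij[of "{M<..N}" B] independent_imp_finite[OF B(4)] by auto
  \<comment> \<open>The vectors in \<open>B\<close> have ambient norm 1, whereas level
    \<open>Suc l\<close> requires the squared norm \<open>N\<close>.\<close>
  define \<psi> where "\<psi> i = (if i \<le> M then ?c i *\<^sub>R psi_minus (\<phi> i) else sqrt N *\<^sub>R b i)" for i
  have low: "\<psi> i = ?c i *\<^sub>R psi_minus (\<phi> i)" if "i \<in> {1..M}" for i
    using that by (simp add: \<psi>_def)
  have high: "\<psi> i = sqrt N *\<^sub>R b i" "b i \<in> B" "b i \<in> level_fun (Suc l)" "psi_plus (b i) = 0"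
    if "i \<in> {M<..N}" for i
  proof -
    show "b i \<in> B"
      using that b by (auto simp: bij_betw_def)
    then have "b i \<in> ?W"
      using B(1) by blast
    then show "b i \<in> level_fun (Suc l)" "psi_plus (b i) = 0"
      by simp_all
    show "\<psi> i = sqrt N *\<^sub>R b i"
      using that by (simp add: \<psi>_def)
  qed
  have orth_low: "\<psi> i \<bullet> \<psi> j = (if i = j then real N else 0)" if "i \<in> {1..M}" "j \<in> {1..M}" for i j
  proof -
    have "\<psi> i \<bullet> \<psi> j = ?c i * ?c j * (\<phi> i \<bullet> psi_plus (psi_minus (\<phi> j)))"
      using that by (simp add: low psi_minus_adjoint)
    also have "\<dots> = ?c i * ?c j * ((?h (Suc l) - ?h (eigenvalue_index n j)) * (\<phi> i \<bullet> \<phi> j))"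
      using psi_plus_psi_minus_eigen[OF \<open>\<alpha> > 0\<close> eig[OF that(2)]] by (simp add: n_def)
    also have "\<dots> = (if i = j then real N else 0)"
    proof (cases "i = j")
      case True
      let ?d = "?h (Suc l) - ?h (eigenvalue_index n j)"
      have d: "?d > 0"
        using johnson_eigenvalue_index_less[of l n j] l that by (simp add: n_def M_def)
      then have "?c j * ?c j = real N / (real M * ?d)"
        by (simp add: raising_constant_def M_def[symmetric] N_def[symmetric])
      then show ?thesis
        using True D(3)[OF ln that] d MN by simp
    qed (use D(3)[OF ln that] in simp)
    finally show ?thesis .
  qed
  have orth_high: "\<psi> i \<bullet> \<psi> j = (if i = j then real N else 0)"
    if "i \<in> {M<..N}" "j \<in> {M<..N}" for i j
  proof (cases "i = j")
    case True
    then show ?thesis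
      using high[OF that(1)] B(3)[of "b i"] by (simp add: dot_square_norm)
  next
    case False
    then have "b i \<noteq> b j"
      using that b by (auto simp: bij_betw_def inj_on_def)
    then show ?thesis
      using False high[OF that(1)] high[OF that(2)] B(2)
      by (simp add: pairwise_def orthogonal_def)
  qed
  \<comment> \<open>Adjointness moves \<open>psi_minus\<close> onto \<open>b j\<close>, which
    \<open>psi_plus\<close> annihilates.\<close>
  have orth_mixed: "\<psi> i \<bullet> \<psi> j = 0" if "i \<in> {1..M}" "j \<in> {M<..N}" for i j
    using that by (simp add: low high psi_minus_adjoint)
  have "\<psi> i \<bullet> \<psi> j = (if i = j then real N else 0)" if "i \<in> {1..N}" "j \<in> {1..N}" for i j
  proof -
    have "i \<in> {1..M} \<or> i \<in> {M<..N}" "j \<in> {1..M} \<or> j \<in> {M<..N}"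
      using that by auto
    then show ?thesis
      using orth_low[of i j] orth_high[of i j] orth_mixed[of i j] orth_mixed[of j i]
      by (auto simp: inner_commute)
  qed
  moreover have "\<psi> i \<in> sep_eigenspace complete_edges \<alpha> (Suc l) (?\<mu> i)" if i: "i \<in> {1..N}" for i
  proof (cases "i \<le> M")
    case True
    then have "i \<in> {1..M}"
      using i by simp
    then show ?thesis
      using psi_minus_eigenspace[OF \<open>\<alpha> > 0\<close> eig]
      by (simp add: low johnson_spectrum_def subspace_scale[OF subspace_sep_eigenspace] \<open>\<alpha> > 0\<close>)
  next
    case False
    \<comment> \<open>An index above \<open>M\<close> fits into level \<open>Suc l\<close> but not
      into level \<open>l\<close>.\<close>
    then have "eigenvalue_index n i = Suc l"
      using i l by (subst eigenvalue_index_eq_iff[of _ _ "Suc l"]) (auto simp: N_def M_def n_def)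
    moreover have "b i \<in> sep_eigenspace complete_edges \<alpha> (Suc l) (\<alpha> * ?h (Suc l))"
      using high[of i] i False by (simp add: sep_eigenspace_iff \<open>\<alpha> > 0\<close> n_def)
    ultimately show ?thesis
      using high(1)[of i] i False
      by (simp add: johnson_spectrum_def subspace_scale[OF subspace_sep_eigenspace] \<open>\<alpha> > 0\<close>)
  qed
  ultimately have "ordered_eigenbasis complete_edges \<alpha> (Suc l) \<psi> ?\<mu>"
    using \<open>\<alpha> > 0\<close> l unfolding N_def n_def by (intro ordered_eigenbasisI)
  then show thesis
    using that low unfolding n_def M_def by blast
qed

lemma ordered_eigenbasis_exists:
  assumes "\<alpha> > 0" "2 * l \<le> CARD('v)"
  shows "\<exists>\<phi> :: nat \<Rightarrow> real ^ ('v::finite config).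
    ordered_eigenbasis complete_edges \<alpha> l \<phi> (johnson_spectrum \<alpha> CARD('v))"
  using assms(2)
proof (induction l)
  case 0
  \<comment> \<open>Level 0 holds only the all-white configuration, and its indicator has the
    required squared norm \<open>CARD('v) choose 0 = 1\<close>.\<close>
  let ?f = "axis (\<lambda>_. False) 1 :: real ^ ('v config)"
  have "?f \<in> level_fun 0"
    by (auto simp: level_fun_def level_def ones_eq_card axis_def)
  moreover have "eigenvalue_index CARD('v) 1 = 0"
    using eigenvalue_index_le_iff[of 1 "CARD('v)" 0 0] by simp
  ultimately have "?f \<in> sep_eigenspace complete_edges \<alpha> 0 (johnson_spectrum \<alpha> CARD('v) 1)"
    using \<open>\<alpha> > 0\<close> by (simp add: johnson_spectrum_def sep_eigenspace_iff psi_plus_level_fun_0)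
  then have "ordered_eigenbasis complete_edges \<alpha> 0 (\<lambda>_. ?f) (johnson_spectrum \<alpha> CARD('v))"
    using \<open>\<alpha> > 0\<close> by (intro ordered_eigenbasisI) (auto simp: inner_axis_axis)
  then show ?case by blast
next
  case (Suc l)
  then obtain \<phi> :: "nat \<Rightarrow> real ^ ('v config)"
    where "ordered_eigenbasis complete_edges \<alpha> l \<phi> (johnson_spectrum \<alpha> CARD('v))"
    by auto
  then show ?case
    using extend_ordered_eigenbasis[OF \<open>\<alpha> > 0\<close> Suc.prems] by blast
qed

text \<open>Uniqueness carries the explicit eigenvalues of the constructed basis over to an
  arbitrary one.\<close>

lemma ordered_eigenbasis_spectrum:
  fixes \<phi> :: "nat \<Rightarrow> real ^ ('v::finite config)"
  assumes "\<alpha> > 0" "2 * l \<le> CARD('v)" "ordered_eigenbasis complete_edges \<alpha> l \<phi> \<nu>"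
    and "i \<in> {1..CARD('v) choose l}"
  shows "\<nu> i = johnson_spectrum \<alpha> CARD('v) i"
proof -
  obtain \<psi> :: "nat \<Rightarrow> real ^ ('v config)"
    where "ordered_eigenbasis complete_edges \<alpha> l \<psi> (johnson_spectrum \<alpha> CARD('v))"
    using ordered_eigenbasis_exists[OF assms(1,2)] by blast
  then show ?thesis
    using assms by (intro ordered_eigenbasis_eigenvalues_unique[of \<alpha> l \<phi> \<nu> \<psi>]) auto
qed

section \<open>Claims (a) and (b): multiplicities and the lowered eigenbasis\<close>

lemma sep_multiplicity_complete:
  assumes "\<alpha> > 0" "2 * l \<le> CARD('v)" "j \<in> {1..l}"
  shows "sep_multiplicity (complete_edges :: 'v::finite set set) \<alpha> l (\<alpha> * johnson_eigenvalue CARD('v) j) =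
    (CARD('v) choose j) - (CARD('v) choose (j - 1))"
proof -
  let ?n = "CARD('v)" and ?\<mu> = "johnson_spectrum \<alpha> CARD('v)"
  obtain \<psi> :: "nat \<Rightarrow> real ^ ('v config)" where "ordered_eigenbasis complete_edges \<alpha> l \<psi> ?\<mu>"
    using ordered_eigenbasis_exists[OF assms(1,2)] by blast
  then have "sep_multiplicity (complete_edges :: 'v set set) \<alpha> l (\<alpha> * johnson_eigenvalue ?n j) =
      card {i \<in> {1..?n choose l}. ?\<mu> i = \<alpha> * johnson_eigenvalue ?n j}"
    unfolding sep_multiplicity_def using assms by (intro dim_sep_eigenspace) auto
  \<comment> \<open>By strict monotonicity the eigenvalue determines
    \<open>eigenvalue_index\<close>, so these indices fit into level \<open>j\<close> but not into
    level \<open>j - 1\<close>.\<close>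
  also have "{i \<in> {1..?n choose l}. ?\<mu> i = \<alpha> * johnson_eigenvalue ?n j} =
      {?n choose (j - 1)<..?n choose j}"
  proof -
    have "?\<mu> i = \<alpha> * johnson_eigenvalue ?n j \<longleftrightarrow> ?n choose (j - 1) < i \<and> i \<le> ?n choose j"
      if "i \<le> ?n choose l" for i
    proof -
      have "eigenvalue_index ?n i \<le> l"
        using that assms eigenvalue_index_le_iff by blast
      then have "?\<mu> i = \<alpha> * johnson_eigenvalue ?n j \<longleftrightarrow> eigenvalue_index ?n i = j"
        using assms johnson_eigenvalue_less_iff[of "eigenvalue_index ?n i" ?n j]
          johnson_eigenvalue_less_iff[of j ?n "eigenvalue_index ?n i"]
        by (auto simp: johnson_spectrum_def)
      then show ?thesis
        using eigenvalue_index_eq_iff[OF that, of j] assms by auto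
    qed
    moreover have "?n choose j \<le> ?n choose l"
      using assms by (intro binomial_mono) auto
    ultimately show ?thesis
      by (auto dest: order_trans)
  qed
  finally show ?thesis by simp
qed

text \<open>By adjointness the Gram matrix is that of \<open>\<psi>\<close> with each row scaled by
  a difference of Johnson eigenvalues. For indices up to \<open>CARD('v) choose l\<close> this
  factor is positive, so the images are nonzero and orthogonal, as many as the dimension.\<close>

lemma orthogonal_eigenbasis_psi_plus:
  fixes \<psi> :: "nat \<Rightarrow> real ^ ('v::finite config)"
  assumes "\<alpha> > 0" "2 * Suc l \<le> CARD('v)"
    and basis: "ordered_eigenbasis complete_edges \<alpha> (Suc l) \<psi> \<mu>"
  shows "orthogonal_eigenbasis complete_edges \<alpha> l (\<lambda>i. psi_plus (\<psi> i))"
proof -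
  let ?n = "CARD('v)" and ?h = "johnson_eigenvalue CARD('v)"
  let ?I = "{1..?n choose l}"
  have sub: "?I \<subseteq> {1..?n choose Suc l}"
    using binomial_mono[of l "Suc l" ?n] assms(2) by auto
  have ln: "Suc l \<le> ?n"
    using assms(2) by simp
  note D = ordered_eigenbasisD[OF basis ln]
  have eig: "\<psi> i \<in> sep_eigenspace complete_edges \<alpha> (Suc l) (\<alpha> * ?h (eigenvalue_index ?n i))"
    if "i \<in> ?I" for i
  proof -
    have i: "i \<in> {1..?n choose Suc l}"
      using that sub by blast
    show ?thesis
      using D(1)[OF i] ordered_eigenbasis_spectrum[OF assms(1,2) basis i]
      by (simp add: johnson_spectrum_def)
  qed
  have inner: "psi_plus (\<psi> i) \<bullet> psi_plus (\<psi> j) =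
      (?h (Suc l) - ?h (eigenvalue_index ?n i)) * (if i = j then real (?n choose Suc l) else 0)"
    if "i \<in> ?I" "j \<in> ?I" for i j
  proof -
    have "i \<in> {1..?n choose Suc l}" "j \<in> {1..?n choose Suc l}"
      using that sub by blast+
    then show ?thesis
      using eig[OF that(1)] D(3)[of i j] \<open>\<alpha> > 0\<close>
      by (simp add: sep_eigenspace_iff psi_minus_adjoint[symmetric])
  qed
  have nz: "psi_plus (\<psi> i) \<noteq> 0" if "i \<in> ?I" for i
    using inner[OF that that] johnson_eigenvalue_index_less[OF assms(2), of i] that ln by auto
  have eig': "psi_plus (\<psi> i) \<in> sep_eigenspace complete_edges \<alpha> l (\<alpha> * ?h (eigenvalue_index ?n i))"
    if "i \<in> ?I" for i
    using \<open>\<alpha> > 0\<close> eig[OF that] by (rule psi_plus_eigenspace)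
  then have lev: "psi_plus (\<psi> i) \<in> level_fun l" if "i \<in> ?I" for i
    using that by (simp add: sep_eigenspace_def)
  have "family_basis ?I (\<lambda>i. psi_plus (\<psi> i)) (level_fun l)"
    using nz lev inner by (intro family_basisI_orthogonal) (auto simp: subspace_level_fun dim_level_fun)
  moreover have "level_inner l (psi_plus (\<psi> i)) (psi_plus (\<psi> j)) = 0"
    if "i \<in> ?I" "j \<in> ?I" "i \<noteq> j" for i j
    using level_inner_eq[OF lev[OF that(1)]] inner[OF that(1,2)] that(3) by simp
  ultimately show ?thesis
    using eig' nz unfolding orthogonal_eigenbasis_def Let_def sep_eigenvector_def by blast
qed

subsection \<open>Sums over subconfigurations\<close>

text \<open>The inclusion operator between \<open>m\<close>-subsets and \<open>l\<close>-subsets,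
  cut off so that it lands in \<open>level_fun l\<close> and can be compared with basis
  vectors.\<close>

definition subset_sum :: "nat \<Rightarrow> nat \<Rightarrow> real ^ ('v::finite config) \<Rightarrow> real ^ ('v config)" where
  "subset_sum m l f = (\<chi> x. if ones x = l then \<Sum>y | y \<le> x \<and> ones y = m. f $ y else 0)"

lemma card_black_diff:
  assumes "y \<le> x"
  shows "card {v. x v \<and> \<not> y v} = ones x - ones y"
proof -
  have "{v. x v \<and> \<not> y v} = {v. x v} - {v. y v}" "{v. y v} \<subseteq> {v. x v}"
    using assms by (auto simp: le_fun_def)
  then show ?thesis
    by (simp add: ones_eq_card card_Diff_subset)
qed

lemma subset_sum_self: "f \<in> level_fun m \<Longrightarrow> subset_sum m m f = f"
proof -
  assume f: "f \<in> level_fun m"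
  have "y = x" if "y \<le> x" "ones y = ones x" for x y :: "'a config"
  proof -
    have "{v. y v} = {v. x v}"
      using that by (intro card_subset_eq) (auto simp: ones_eq_card le_fun_def)
    then show ?thesis by auto
  qed
  then have "{y. y \<le> x \<and> ones y = m} = {x}" if "ones x = m" for x :: "'a config"
    using that by auto
  then show ?thesis
    using level_fun_nth_eq_0[OF f] by (simp add: subset_sum_def vec_eq_iff)
qed

text \<open>Double counting: \<open>y\<close> below \<open>x\<close> stays below after emptying
  \<open>v\<close> exactly when \<open>y\<close> is white at \<open>v\<close>, so it is counted once
  for each of the \<open>Suc l - m\<close> black vertices of \<open>x\<close> outside
  \<open>y\<close>.\<close>

lemma psi_minus_subset_sum:
  "psi_minus (subset_sum m l f) = real (Suc l - m) *\<^sub>R subset_sum m (Suc l) f"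
proof (subst vec_eq_iff, rule allI)
  fix x
  show "psi_minus (subset_sum m l f) $ x = (real (Suc l - m) *\<^sub>R subset_sum m (Suc l) f) $ x"
  proof (cases "ones x = Suc l")
    case True
    let ?Y = "{y. y \<le> x \<and> ones y = m}"
    have "psi_minus (subset_sum m l f) $ x = (\<Sum>v | x v. \<Sum>y | y \<in> ?Y \<and> \<not> y v. f $ y)"
      unfolding psi_minus_def vec_lambda_beta
    proof (rule sum.cong[OF refl])
      fix v assume "v \<in> {v. x v}"
      then have v: "x v" by simp
      have "ones (flip_at v x) = l"
        using ones_flip_at_black[of x, OF v] True by simp
      moreover have "{y. y \<le> flip_at v x \<and> ones y = m} = {y. y \<in> ?Y \<and> \<not> y v}"
        using v by (auto simp: le_fun_def flip_at_apply split: if_splits)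
      ultimately show "subset_sum m l f $ flip_at v x = (\<Sum>y | y \<in> ?Y \<and> \<not> y v. f $ y)"
        by (simp add: subset_sum_def)
    qed
    also have "\<dots> = (\<Sum>y\<in>?Y. \<Sum>v | v \<in> {v. x v} \<and> \<not> y v. f $ y)"
      by (rule sum.swap_restrict) auto
    also have "\<dots> = (\<Sum>y\<in>?Y. real (Suc l - m) * f $ y)"
      using True by (intro sum.cong) (auto simp: card_black_diff)
    also have "\<dots> = (real (Suc l - m) *\<^sub>R subset_sum m (Suc l) f) $ x"
      using True by (simp add: subset_sum_def sum_distrib_left)
    finally show ?thesis .
  next
    case False
    then have "subset_sum m l f $ flip_at v x = 0" if "x v" for v
      using ones_flip_at_black[of x, OF that] by (auto simp: subset_sum_def)
    then show ?thesis
      using False by (simp add: psi_minus_def) (simp add: subset_sum_def)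
  qed
qed

text \<open>Raises one level at a time. The constants are chosen before the basis on level
  \<open>m\<close>, so they depend on the parameters and the index only.\<close>

lemma iterated_extension:
  assumes "\<alpha> > 0" "m \<le> l" "2 * l \<le> CARD('v)"
  shows "\<exists>C. (\<forall>i\<in>{1..CARD('v) choose m}. C i > 0) \<and>
    (\<forall>\<phi> \<nu>. ordered_eigenbasis (complete_edges :: 'v::finite set set) \<alpha> m \<phi> \<nu> \<longrightarrow>
      (\<exists>\<psi>. ordered_eigenbasis complete_edges \<alpha> l \<psi> (johnson_spectrum \<alpha> CARD('v)) \<and>
        (\<forall>i\<in>{1..CARD('v) choose m}. \<psi> i = C i *\<^sub>R subset_sum m l (\<phi> i))))"
  using assms(2,3)
proof (induction l rule: dec_induct)
  case base
  let ?n = "CARD('v)"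
  have "ordered_eigenbasis complete_edges \<alpha> m \<phi> (johnson_spectrum \<alpha> ?n) \<and>
      (\<forall>i\<in>{1..?n choose m}. \<phi> i = 1 *\<^sub>R subset_sum m m (\<phi> i))"
    if basis: "ordered_eigenbasis (complete_edges :: 'v set set) \<alpha> m \<phi> \<nu>" for \<phi> \<nu>
  proof -
    have mn: "m \<le> ?n"
      using base by simp
    show ?thesis
      using ordered_eigenbasisD[OF basis mn] ordered_eigenbasis_spectrum[OF assms(1) base basis]
      by (intro conjI ordered_eigenbasisI[OF assms(1) base]) (auto simp: subset_sum_self)
  qed
  then show ?case
    by (intro exI[of _ "\<lambda>_. 1"]) auto
next
  case (step l)
  let ?n = "CARD('v)"
  have "2 * l \<le> ?n"
    using step.prems by simp
  from step.IH[OF this] obtain C where C: "\<forall>i\<in>{1..?n choose m}. C i > 0"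
    "\<And>\<phi> \<nu>. ordered_eigenbasis (complete_edges :: 'v set set) \<alpha> m \<phi> \<nu> \<Longrightarrow>
      \<exists>\<psi>. ordered_eigenbasis complete_edges \<alpha> l \<psi> (johnson_spectrum \<alpha> ?n) \<and>
        (\<forall>i\<in>{1..?n choose m}. \<psi> i = C i *\<^sub>R subset_sum m l (\<phi> i))"
    by blast
  \<comment> \<open>\<open>raising_constant\<close> normalizes the raised vector, and
    \<open>Suc l - m\<close> is the multiplicity from \<open>psi_minus_subset_sum\<close>.\<close>
  define C' where "C' i = raising_constant ?n l i * (C i * real (Suc l - m))" for i
  have sub: "{1..?n choose m} \<subseteq> {1..?n choose l}"
    using binomial_mono[of m l ?n] step by auto
  have "C' i > 0" if "i \<in> {1..?n choose m}" for i
    using bspec[OF C(1) that] raising_constant_pos[of l ?n i] step that sub by (auto simp: C'_def)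
  moreover have "\<exists>\<psi>. ordered_eigenbasis complete_edges \<alpha> (Suc l) \<psi> (johnson_spectrum \<alpha> ?n) \<and>
        (\<forall>i\<in>{1..?n choose m}. \<psi> i = C' i *\<^sub>R subset_sum m (Suc l) (\<phi> i))"
    if basis: "ordered_eigenbasis (complete_edges :: 'v set set) \<alpha> m \<phi> \<nu>" for \<phi> \<nu>
  proof -
    obtain \<psi> where \<psi>: "ordered_eigenbasis complete_edges \<alpha> l \<psi> (johnson_spectrum \<alpha> ?n)"
      "\<forall>i\<in>{1..?n choose m}. \<psi> i = C i *\<^sub>R subset_sum m l (\<phi> i)"
      using C(2)[OF basis] by blast
    obtain \<xi> where "ordered_eigenbasis complete_edges \<alpha> (Suc l) \<xi> (johnson_spectrum \<alpha> ?n)"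
      and \<xi>: "\<And>i. i \<in> {1..?n choose l} \<Longrightarrow> \<xi> i = raising_constant ?n l i *\<^sub>R psi_minus (\<psi> i)"
      using extend_ordered_eigenbasis[OF assms(1) step.prems \<psi>(1) refl] by blast
    moreover have "\<xi> i = C' i *\<^sub>R subset_sum m (Suc l) (\<phi> i)" if "i \<in> {1..?n choose m}" for i
      using \<xi>[of i] \<psi>(2) that sub
      by (auto simp: psi_minus_scaleR psi_minus_subset_sum C'_def)
    ultimately show ?thesis by blast
  qed
  ultimately show ?case by blast
qed

text \<open>Choosing the constants before the eigenbases expresses on what they may depend. In (a)
  integers avoid truncated subtraction; in (d) the index bound ensures that \<open>\<phi> i\<close>
  belongs to the basis on level \<open>m\<close>.\<close>

theorem proposition3p1:
  fixes n :: nat and \<alpha> :: real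
  defines "K \<equiv> (complete_edges :: 'v::finite set set)"
  assumes "n > 0" and "CARD('v) = n" and "\<alpha> > 0"
  shows "\<forall>l\<in>{1..n div 2}.
    (\<forall>j\<in>{1..l}. int (sep_multiplicity K \<alpha> l (\<alpha> * real j * (real n - real j + 1)))
        = int (n choose j) - int (n choose (j - 1))) \<and>
    (\<forall>\<psi> \<mu>. ordered_eigenbasis K \<alpha> l \<psi> \<mu> \<longrightarrow>
        orthogonal_eigenbasis K \<alpha> (l - 1) (\<lambda>i. psi_plus (\<psi> i))) \<and>
    (\<exists>C. (\<forall>i\<in>{1..n choose (l - 1)}. C i > 0) \<and>
        (\<forall>\<phi> \<nu>. ordered_eigenbasis K \<alpha> (l - 1) \<phi> \<nu> \<longrightarrow>
          (\<exists>\<psi> \<mu>. ordered_eigenbasis K \<alpha> l \<psi> \<mu> \<and>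
            (\<forall>i\<in>{1..n choose (l - 1)}. \<psi> i = C i *\<^sub>R psi_minus (\<phi> i))))) \<and>
    (\<forall>m<l.
      (\<exists>C'. (\<forall>i\<in>{1..n choose m}. C' i > 0) \<and>
        (\<forall>\<phi> \<nu>. ordered_eigenbasis K \<alpha> m \<phi> \<nu> \<longrightarrow>
          (\<exists>\<psi> \<mu>. ordered_eigenbasis K \<alpha> l \<psi> \<mu> \<and>
            (\<forall>i\<in>{1..n choose l}. \<mu> i \<le> \<alpha> * real m * (real n - real m + 1) \<longrightarrow>
              i \<le> n choose m \<and>
              (\<forall>x\<in>level l. \<psi> i $ x = C' i * (\<Sum>y | y \<le> x \<and> ones y = m. \<phi> i $ y)))))) \<and>
      (\<forall>\<phi> \<nu> \<psi> \<mu>. ordered_eigenbasis K \<alpha> m \<phi> \<nu> \<longrightarrow> ordered_eigenbasis K \<alpha> l \<psi> \<mu> \<longrightarrow>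
        (\<forall>i\<in>{1..n choose l}. \<mu> i \<le> \<alpha> * real m * (real n - real m + 1) \<longrightarrow>
          i \<le> n choose m \<and> \<mu> i = \<nu> i)))"
proof (intro ballI, goal_cases)
  case (1 l)
  obtain k where k: "l = Suc k"
    using 1 by (cases l) auto
  have n: "n = CARD('v)"
    using assms by simp
  have l: "2 * l \<le> CARD('v)"
    using 1(1) by (simp add: n[symmetric] less_eq_div_iff_mult_less_eq mult.commute)
  have ev: "\<alpha> * real j * (real n - real j + 1) = \<alpha> * johnson_eigenvalue n j" for j
    by (simp add: johnson_eigenvalue_def)
  show ?case
    unfolding ev
  proof (intro conjI allI impI, goal_cases)
    case 1
    \<comment> \<open>Monotonicity up to \<open>n / 2\<close> makes the natural subtraction agree
      with the integer one.\<close>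
    have "n choose (j - 1) \<le> n choose j" if "j \<in> {1..l}" for j
      using that l by (intro binomial_mono) (auto simp: n)
    then show ?case
      using sep_multiplicity_complete[OF \<open>\<alpha> > 0\<close> l] unfolding K_def n by (simp add: of_nat_diff)
  next
    case (2 \<psi> \<mu>)
    then show ?case
      using orthogonal_eigenbasis_psi_plus[OF \<open>\<alpha> > 0\<close>, of k \<psi> \<mu>] l by (simp add: K_def k)
  next
    case 3
    have "\<exists>\<psi> \<mu>. ordered_eigenbasis K \<alpha> l \<psi> \<mu> \<and>
        (\<forall>i\<in>{1..n choose k}. \<psi> i = raising_constant n k i *\<^sub>R psi_minus (\<phi> i))"
      if basis: "ordered_eigenbasis K \<alpha> k \<phi> \<nu>" for \<phi> \<nu>
    proof -
      note basis' = basis[unfolded K_def]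
      have k2: "2 * k \<le> CARD('v)"
        using l k by simp
      obtain \<psi> where
        "ordered_eigenbasis complete_edges \<alpha> (Suc k) \<psi> (johnson_spectrum \<alpha> CARD('v))"
        "\<And>i. i \<in> {1..CARD('v) choose k} \<Longrightarrow>
          \<psi> i = raising_constant CARD('v) k i *\<^sub>R psi_minus (\<phi> i)"
        using extend_ordered_eigenbasis[OF \<open>\<alpha> > 0\<close> l[unfolded k] basis'
            ordered_eigenbasis_spectrum[OF \<open>\<alpha> > 0\<close> k2 basis']] by blast
      then show ?thesis
        unfolding K_def n k by (intro exI conjI ballI)
    qed
    moreover have "raising_constant n k i > 0" if "i \<in> {1..n choose k}" for i
      using that l k by (intro raising_constant_pos) (auto simp: n)
    ultimately show ?case
      unfolding k diff_Suc_1 by blast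
  next
    case (4 m)
    then have m: "2 * m \<le> n" "m \<le> l"
      using l by (simp_all add: n)
    obtain C where C: "\<forall>i\<in>{1..n choose m}. C i > 0"
      "\<And>\<phi> \<nu>. ordered_eigenbasis K \<alpha> m \<phi> \<nu> \<Longrightarrow>
        \<exists>\<psi>. ordered_eigenbasis K \<alpha> l \<psi> (johnson_spectrum \<alpha> n) \<and>
          (\<forall>i\<in>{1..n choose m}. \<psi> i = C i *\<^sub>R subset_sum m l (\<phi> i))"
      using iterated_extension[OF \<open>\<alpha> > 0\<close> m(2) l] unfolding K_def n by blast
    show ?case
    proof (intro exI[of _ C] conjI allI impI C(1), goal_cases)
      case (1 \<phi> \<nu>)
      then obtain \<psi> where \<psi>: "ordered_eigenbasis K \<alpha> l \<psi> (johnson_spectrum \<alpha> n)"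
        "\<forall>i\<in>{1..n choose m}. \<psi> i = C i *\<^sub>R subset_sum m l (\<phi> i)"
        using C(2) by blast
      have "i \<le> n choose m \<and> (\<forall>x\<in>level l. \<psi> i $ x = C i * (\<Sum>y | y \<le> x \<and> ones y = m. \<phi> i $ y))"
        if "i \<in> {1..n choose l}" "johnson_spectrum \<alpha> n i \<le> \<alpha> * johnson_eigenvalue n m" for i
      proof -
        \<comment> \<open>The eigenvalue bound places \<open>i\<close> among the indices at which
          \<open>\<psi> i\<close> is built from \<open>\<phi> i\<close>.\<close>
        have "i \<le> n choose m"
          using johnson_spectrum_le_iff[OF \<open>\<alpha> > 0\<close>, of i n l m] that l m by (simp add: n)
        then show ?thesis
          using \<psi>(2) that(1) by (auto simp: subset_sum_def level_def)
      qed
      then show ?case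
        using \<psi>(1) by blast
    qed
  next
    case (5 m \<phi> \<nu> \<psi> \<mu>)
    then have m: "2 * m \<le> CARD('v)" "m \<le> l"
      using l by simp_all
    show ?case
    proof (intro ballI impI)
      fix i assume i: "i \<in> {1..n choose l}" "\<mu> i \<le> \<alpha> * johnson_eigenvalue n m"
      \<comment> \<open>\<open>johnson_spectrum\<close> does not mention the level, so the bases on
        levels \<open>l\<close> and \<open>m\<close> share their \<open>i\<close>th
        eigenvalue.\<close>
      have \<mu>: "\<mu> i = johnson_spectrum \<alpha> n i"
        using ordered_eigenbasis_spectrum[OF \<open>\<alpha> > 0\<close> l 5(3)[unfolded K_def]] i(1) by (simp add: n)
      then have im: "i \<le> n choose m"
        using johnson_spectrum_le_iff[OF \<open>\<alpha> > 0\<close>, of i n l m] i l m by (simp add: n)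
      then show "i \<le> n choose m \<and> \<mu> i = \<nu> i"
        using ordered_eigenbasis_spectrum[OF \<open>\<alpha> > 0\<close> m(1) 5(2)[unfolded K_def], of i] i(1) \<mu>
        by (simp add: n)
    qed
  qed
qed

end
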